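(* Fix integers $\Delta\ge 2$ and $\gamma\ge 0$, and let $P_{\Delta,\gamma}(n)$ be the number of sweep-covers with exactly $n$ subcovers of the infinite tree $\mathcal{T}_{\Delta,\gamma}$. Then, as $n\to\infty$, $$P_{\Delta,\gamma}(n)=\Omega\left(\frac{\sqrt{2\pi}\,n^{\Delta n+\Delta+\frac32}}{e^{n}\,((\Delta-1)n+\Delta+1)!\,(n+1)!}\,\gamma\right).$$
   Context: All trees are rooted and directed away from the root; nodes are labeled (distinguishable). Ancestors and descendants of a node are strict. A sweep-cover of a tree with vertex set $\mathcal V$ is a collection $S$ of non-empty subsets of $\mathcal V$ (called subcovers) such that: (1) distinct members of $S$ are disjoint; (2) each member of $S$ contains only sibling nodes, i.e. nodes sharing a parent (the singleton of the root is allowed); (3) with $\mathcal C=\bigcup_{S_i\in S}S_i$, every node of $\mathcal V$ is in $\mathcal C$, or is an ancestor of a node of $\mathcal C$, or is a descendant of a node of $\mathcal C$; (4) no node of $\mathcal C$ is an ancestor or descendant of another node of $\mathcal C$. The tree $\mathcal{T}_{\Delta,\gamma}$ is the infinite rooted directed tree all of whose nodes have out-degree $\Delta$ ("$\Delta$-star nodes") or out-degree $1$, arranged so that each child of a $\Delta$-star node is joined to the next $\Delta$-star node below it by a path with exactly $\gamma$ edges (so if $\gamma=0$ the child is itself a $\Delta$-star node); likewise the root is joined to the first $\Delta$-star node by a path with exactly $\gamma$ edges. Thus the subtree of descendants hanging from any child of a $\Delta$-star node is isomorphic to $\mathcal{T}_{\Delta,\gamma}$. $f(n)=\Omega(g(n))$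 means there are a constant $c>0$ and $n_0$ with $f(n)\ge c\,g(n)$ for all $n\ge n_0$. *)

theory Defs
  imports Complex_Main "HOL-Library.Landau_Symbols"
begin

text \<open>
  A rooted directed tree is given by its node set \<open>V\<close>, its set of arcs \<open>E\<close> (pairs of a parent and
  its child) and its root \<open>r\<close>. The strict ancestor relation is the transitive closure \<open>E\<^sup>+\<close>.
\<close>

definition sweep_cover :: "'a set \<Rightarrow> ('a \<times> 'a) set \<Rightarrow> 'a \<Rightarrow> 'a set set \<Rightarrow> bool" where
  "sweep_cover V E r S \<longleftrightarrow>
     (\<forall>s\<in>S. s \<noteq> {} \<and> s \<subseteq> V) \<and>
     (\<forall>s\<in>S. \<forall>t\<in>S. s \<noteq> t \<longrightarrow> s \<inter> t = {}) \<and>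
     (\<forall>s\<in>S. s = {r} \<or> (\<exists>p\<in>V. \<forall>x\<in>s. (p, x) \<in> E)) \<and>
     (\<forall>v\<in>V. v \<in> \<Union>S \<or> (\<exists>c\<in>\<Union>S. (v, c) \<in> E\<^sup>+) \<or> (\<exists>c\<in>\<Union>S. (c, v) \<in> E\<^sup>+)) \<and>
     (\<forall>c\<in>\<Union>S. \<forall>d\<in>\<Union>S. (c, d) \<notin> E\<^sup>+)"

text \<open>
  Nodes of the tree are encoded by the sequence of child indices along the path from the root.
  The out-degree depends only on the depth: the first \<open>\<Delta>\<close>-star node is \<open>\<gamma>\<close> edges below the root,
  and consecutive \<open>\<Delta>\<close>-star nodes on a branch are \<open>\<gamma> + 1\<close> edges apart (one edge to the child,
  then \<open>\<gamma>\<close> edges to the next \<open>\<Delta>\<close>-star node). Hence the \<open>\<Delta>\<close>-star nodes are those at the depths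
  \<open>\<gamma> + k (\<gamma> + 1)\<close>.
\<close>

definition star_tree_outdeg :: "nat \<Rightarrow> nat \<Rightarrow> nat list \<Rightarrow> nat" where
  "star_tree_outdeg \<Delta> \<gamma> v = (if length v mod (\<gamma> + 1) = \<gamma> then \<Delta> else 1)"

inductive_set star_tree_nodes :: "nat \<Rightarrow> nat \<Rightarrow> nat list set" for \<Delta> \<gamma> :: nat where
  root: "[] \<in> star_tree_nodes \<Delta> \<gamma>"
| child: "v \<in> star_tree_nodes \<Delta> \<gamma> \<Longrightarrow> i < star_tree_outdeg \<Delta> \<gamma> v \<Longrightarrow> v @ [i] \<in> star_tree_nodes \<Delta> \<gamma>"

definition star_tree_arcs :: "nat \<Rightarrow> nat \<Rightarrow> (nat list \<times> nat list) set" where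
  "star_tree_arcs \<Delta> \<gamma> =
     {(v, v @ [i]) | v i. v \<in> star_tree_nodes \<Delta> \<gamma> \<and> i < star_tree_outdeg \<Delta> \<gamma> v}"

text \<open>
  For \<open>\<Delta> \<ge> 2\<close> the set of sweep-covers below is finite: wherever the cover continues strictly
  below a child of a \<open>\<Delta>\<close>-star node, the other children contribute at least one further subcover,
  so \<open>n\<close> bounds the depth of the cover. Hence \<open>card\<close> is the true count.
\<close>

definition num_sweep_covers :: "nat \<Rightarrow> nat \<Rightarrow> nat \<Rightarrow> nat" where
  "num_sweep_covers \<Delta> \<gamma> n =
     card {S. sweep_cover (star_tree_nodes \<Delta> \<gamma>) (star_tree_arcs \<Delta> \<gamma>) [] S \<and> finite S \<and> card S = n}"


text \<open>The encoding yields a rooted tree with the described out-degrees and self-similarity.\<close>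

lemma star_tree_arcs_subset:
  "star_tree_arcs \<Delta> \<gamma> \<subseteq> star_tree_nodes \<Delta> \<gamma> \<times> star_tree_nodes \<Delta> \<gamma>"
  by (auto simp: star_tree_arcs_def intro: star_tree_nodes.child)

lemma star_tree_root_no_parent: "(p, []) \<notin> star_tree_arcs \<Delta> \<gamma>"
  by (auto simp: star_tree_arcs_def)

lemma star_tree_parent_unique:
  "(p, v) \<in> star_tree_arcs \<Delta> \<gamma> \<Longrightarrow> (q, v) \<in> star_tree_arcs \<Delta> \<gamma> \<Longrightarrow> p = q"
  by (auto simp: star_tree_arcs_def)

lemma star_tree_reachable:
  "v \<in> star_tree_nodes \<Delta> \<gamma> \<Longrightarrow> ([], v) \<in> (star_tree_arcs \<Delta> \<gamma>)\<^sup>*"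
proof (induction rule: star_tree_nodes.induct)
  case (child v i)
  then have "(v, v @ [i]) \<in> star_tree_arcs \<Delta> \<gamma>" by (auto simp: star_tree_arcs_def)
  with child.IH show ?case by (rule rtrancl_into_rtrancl)
qed simp

lemma star_tree_card_children:
  assumes "v \<in> star_tree_nodes \<Delta> \<gamma>"
  shows "card (star_tree_arcs \<Delta> \<gamma> `` {v}) = star_tree_outdeg \<Delta> \<gamma> v"
proof -
  have "star_tree_arcs \<Delta> \<gamma> `` {v} = (\<lambda>i. v @ [i]) ` {..<star_tree_outdeg \<Delta> \<gamma> v}"
    using assms by (auto simp: star_tree_arcs_def)
  then show ?thesis by (simp add: card_image inj_on_def)
qed

lemma star_tree_nodes_snoc:
  "v @ [i] \<in> star_tree_nodes \<Delta> \<gamma> \<longleftrightarrow>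
     v \<in> star_tree_nodes \<Delta> \<gamma> \<and> i < star_tree_outdeg \<Delta> \<gamma> v"
  by (auto intro: star_tree_nodes.child elim: star_tree_nodes.cases)

lemma star_tree_self_similar:
  assumes "u \<in> star_tree_nodes \<Delta> \<gamma>" and "length u mod (\<gamma> + 1) = \<gamma>" and "i < \<Delta>"
  shows "(u @ [i]) @ w \<in> star_tree_nodes \<Delta> \<gamma> \<longleftrightarrow> w \<in> star_tree_nodes \<Delta> \<gamma>"
proof (induction w rule: rev_induct)
  case Nil
  show ?case using assms by (simp add: star_tree_nodes_snoc star_tree_outdeg_def star_tree_nodes.root)
next
  case (snoc j w)
  have "length ((u @ [i]) @ w) mod (\<gamma> + 1) = (length u mod (\<gamma> + 1) + (1 + length w)) mod (\<gamma> + 1)"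
    using mod_add_left_eq[of "length u" "\<gamma> + 1" "1 + length w"] by simp
  also have "\<dots> = ((\<gamma> + 1) + length w) mod (\<gamma> + 1)"
    using assms(2) by simp
  also have "\<dots> = length w mod (\<gamma> + 1)"
    by (rule mod_add_self1)
  finally have "star_tree_outdeg \<Delta> \<gamma> ((u @ [i]) @ w) = star_tree_outdeg \<Delta> \<gamma> w"
    by (simp add: star_tree_outdeg_def)
  with snoc.IH show ?case
    using star_tree_nodes_snoc[of "(u @ [i]) @ w" j] star_tree_nodes_snoc[of w j] by simp
qed

end

theory Submission imports Defs "HOL-Library.Sublist" begin

text \<open>
  Below the first star node, place a sweep-cover with \<open>n\<close> subcovers into the subtree of one child
  and cover all other subtrees with a single subcover. For \<open>\<gamma> \<ge> 1\<close> there are at least three ways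
  of doing this: three choices of the child if \<open>\<Delta> \<ge> 3\<close>, and if \<open>\<Delta> = 2\<close> the single node covering
  the other subtree can be the child itself or the node below it. So the number of sweep-covers at
  least triples from \<open>n\<close> to \<open>n + 1\<close>. On the other hand, \<open>m! \<ge> (m/e)\<^sup>m\<close> bounds the claimed
  expression by a constant times \<open>((e/d)\<^sup>d)\<^sup>n\<close> with \<open>d = \<Delta> - 1\<close>, and \<open>(e/d)\<^sup>d \<le> e < 3\<close>.
\<close>

section \<open>Sweep-covers in terms of the prefix order\<close>

lemma star_tree_nodes_prefix:
  "prefix v w \<Longrightarrow> w \<in> star_tree_nodes \<Delta> \<gamma> \<Longrightarrow> v \<in> star_tree_nodes \<Delta> \<gamma>"
  by (induction w rule: rev_induct) (auto simp: star_tree_nodes_snoc)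

lemma star_tree_arcs_iff:
  "(p, x) \<in> star_tree_arcs \<Delta> \<gamma> \<longleftrightarrow> x \<in> star_tree_nodes \<Delta> \<gamma> \<and> (\<exists>k. x = p @ [k])"
  by (auto simp: star_tree_arcs_def star_tree_nodes_snoc)

lemma star_tree_ancestor_iff:
  "(v, w) \<in> (star_tree_arcs \<Delta> \<gamma>)\<^sup>+ \<longleftrightarrow> w \<in> star_tree_nodes \<Delta> \<gamma> \<and> strict_prefix v w"
proof
  assume "(v, w) \<in> (star_tree_arcs \<Delta> \<gamma>)\<^sup>+"
  then show "w \<in> star_tree_nodes \<Delta> \<gamma> \<and> strict_prefix v w"
    by (induction rule: trancl_induct)
      (auto simp: star_tree_arcs_iff strict_prefix_def)
next
  assume "w \<in> star_tree_nodes \<Delta> \<gamma> \<and> strict_prefix v w"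
  then show "(v, w) \<in> (star_tree_arcs \<Delta> \<gamma>)\<^sup>+"
  proof (induction w rule: rev_induct)
    case (snoc k w)
    then have arc: "(w, w @ [k]) \<in> star_tree_arcs \<Delta> \<gamma>" and w: "w \<in> star_tree_nodes \<Delta> \<gamma>"
      by (auto simp: star_tree_arcs_iff star_tree_nodes_snoc)
    from snoc.prems consider "v = w" | "strict_prefix v w"
      by (auto simp: strict_prefix_def)
    then show ?case
    proof cases
      case 2
      with snoc.IH w have "(v, w) \<in> (star_tree_arcs \<Delta> \<gamma>)\<^sup>+" by blast
      from this arc show ?thesis by (rule trancl_into_trancl)
    qed (use arc in auto)
  qed simp
qed

text \<open>Each arc appends one index, so strict ancestry is the strict prefix order. That the
  common parent is a node comes for free: subcovers are non-empty and the node set is closed under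
  prefixes.\<close>

lemma sweep_cover_star_tree_iff:
  "sweep_cover (star_tree_nodes \<Delta> \<gamma>) (star_tree_arcs \<Delta> \<gamma>) [] S \<longleftrightarrow>
     (\<forall>s\<in>S. s \<noteq> {} \<and> s \<subseteq> star_tree_nodes \<Delta> \<gamma>) \<and>
     (\<forall>s\<in>S. \<forall>t\<in>S. s \<noteq> t \<longrightarrow> s \<inter> t = {}) \<and>
     (\<forall>s\<in>S. s = {[]} \<or> (\<exists>p. \<forall>x\<in>s. \<exists>k. x = p @ [k])) \<and>
     (\<forall>v\<in>star_tree_nodes \<Delta> \<gamma>. \<exists>c\<in>\<Union>S. prefix v c \<or> prefix c v) \<and>
     (\<forall>c\<in>\<Union>S. \<forall>d\<in>\<Union>S. \<not> strict_prefix c d)" (is "?L \<longleftrightarrow> ?R")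
proof (cases "\<forall>s\<in>S. s \<noteq> {} \<and> s \<subseteq> star_tree_nodes \<Delta> \<gamma>")
  case True
  have sib: "(\<exists>p\<in>star_tree_nodes \<Delta> \<gamma>. \<forall>x\<in>s. (p, x) \<in> star_tree_arcs \<Delta> \<gamma>) \<longleftrightarrow>
      (\<exists>p. \<forall>x\<in>s. \<exists>k. x = p @ [k])" if "s \<in> S" for s
    using True that unfolding star_tree_arcs_iff
    by (metis (no_types, lifting) all_not_in_conv star_tree_nodes_snoc subsetD)
  have cov: "v \<in> \<Union>S \<or> (\<exists>c\<in>\<Union>S. (v, c) \<in> (star_tree_arcs \<Delta> \<gamma>)\<^sup>+) \<or>
      (\<exists>c\<in>\<Union>S. (c, v) \<in> (star_tree_arcs \<Delta> \<gamma>)\<^sup>+) \<longleftrightarrow> (\<exists>c\<in>\<Union>S. prefix v c \<or> prefix c v)"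
    if "v \<in> star_tree_nodes \<Delta> \<gamma>" for v
    using True that unfolding star_tree_ancestor_iff strict_prefix_def by blast
  have anti: "(c, d) \<notin> (star_tree_arcs \<Delta> \<gamma>)\<^sup>+ \<longleftrightarrow> \<not> strict_prefix c d" if "d \<in> \<Union>S" for c d
    using True that unfolding star_tree_ancestor_iff by blast
  show ?thesis
    unfolding sweep_cover_def
    by (intro conj_cong ball_cong disj_cong refl) (erule sib cov anti)+
qed (auto simp: sweep_cover_def)

lemma sweep_coverD:
  assumes S: "sweep_cover (star_tree_nodes \<Delta> \<gamma>) (star_tree_arcs \<Delta> \<gamma>) [] S"
  shows sweep_cover_nonempty: "s \<in> S \<Longrightarrow> s \<noteq> {}"
    and sweep_cover_subset: "s \<in> S \<Longrightarrow> s \<subseteq> star_tree_nodes \<Delta> \<gamma>"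
    and sweep_cover_disjoint: "s \<in> S \<Longrightarrow> t \<in> S \<Longrightarrow> s \<noteq> t \<Longrightarrow> s \<inter> t = {}"
    and sweep_cover_siblings: "s \<in> S \<Longrightarrow> s = {[]} \<or> (\<exists>p. \<forall>x\<in>s. \<exists>k. x = p @ [k])"
    and sweep_cover_covers: "v \<in> star_tree_nodes \<Delta> \<gamma> \<Longrightarrow> \<exists>c\<in>\<Union>S. prefix v c \<or> prefix c v"
    and sweep_cover_antichain: "c \<in> \<Union>S \<Longrightarrow> d \<in> \<Union>S \<Longrightarrow> \<not> strict_prefix c d"
proof -
  note S' = S[unfolded sweep_cover_star_tree_iff]
  note S1 = conjunct1[OF S'] and R1 = conjunct2[OF S']
  note S2 = conjunct1[OF R1] and R2 = conjunct2[OF R1]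
  note S3 = conjunct1[OF R2] and R3 = conjunct2[OF R2]
  note S4 = conjunct1[OF R3] and S5 = conjunct2[OF R3]
  show "s \<in> S \<Longrightarrow> s \<noteq> {}" using S1 by simp
  show "s \<in> S \<Longrightarrow> s \<subseteq> star_tree_nodes \<Delta> \<gamma>" using S1 by simp
  show "s \<in> S \<Longrightarrow> t \<in> S \<Longrightarrow> s \<noteq> t \<Longrightarrow> s \<inter> t = {}" by (rule S2[rule_format])
  show "s \<in> S \<Longrightarrow> s = {[]} \<or> (\<exists>p. \<forall>x\<in>s. \<exists>k. x = p @ [k])" by (rule S3[THEN bspec])
  show "v \<in> star_tree_nodes \<Delta> \<gamma> \<Longrightarrow> \<exists>c\<in>\<Union>S. prefix v c \<or> prefix c v" by (rule S4[THEN bspec])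
  show "c \<in> \<Union>S \<Longrightarrow> d \<in> \<Union>S \<Longrightarrow> \<not> strict_prefix c d" by (rule S5[THEN bspec, THEN bspec])
qed

section \<open>Finiteness\<close>

text \<open>At a star depth \<open>l\<close> on the way to \<open>c\<close> there is another child
  to be covered. A covering node at or above \<open>take l c\<close> would be a strict ancestor of
  \<open>c\<close>, so it lies inside the subtree of that child and leaves the path to
  \<open>c\<close> exactly at depth \<open>l\<close>.\<close>

lemma sweep_cover_branch:
  assumes S: "sweep_cover (star_tree_nodes \<Delta> \<gamma>) (star_tree_arcs \<Delta> \<gamma>) [] S"
    and "\<Delta> \<ge> 2" and c: "c \<in> \<Union>S" and l: "l < length c" and star: "l mod (\<gamma> + 1) = \<gamma>"
  obtains s x where "s \<in> S" "x \<in> s" "l < length x" "take l x = take l c" "x ! l \<noteq> c ! l"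
proof -
  define w where "w = take l c"
  \<comment> \<open>A child index off the path to \<open>c\<close>; both 0 and 1 are available since
    \<open>\<Delta> \<ge> 2\<close>.\<close>
  define i where "i = (if c ! l = 0 then 1 else 0 :: nat)"
  have lw: "length w = l" using l by (simp add: w_def)
  have cV: "c \<in> star_tree_nodes \<Delta> \<gamma>" using c sweep_cover_subset[OF S] by blast
  then have "w \<in> star_tree_nodes \<Delta> \<gamma>"
    using star_tree_nodes_prefix take_is_prefix unfolding w_def by blast
  moreover have "i < star_tree_outdeg \<Delta> \<gamma> w"
    using lw star \<open>\<Delta> \<ge> 2\<close> by (simp add: star_tree_outdeg_def i_def)
  ultimately have "w @ [i] \<in> star_tree_nodes \<Delta> \<gamma>"
    by (rule star_tree_nodes.child)
  from sweep_cover_covers[OF S this]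
  obtain d where d: "d \<in> \<Union>S" "prefix (w @ [i]) d \<or> prefix d (w @ [i])" by blast
  have "\<not> strict_prefix d c" using sweep_cover_antichain[OF S d(1) c] .
  moreover have "strict_prefix d c" if "prefix d w"
  proof -
    have "strict_prefix w c" using l unfolding w_def
      by (metis append_take_drop_id lw nat_less_le prefixI strict_prefix_def w_def)
    with that show ?thesis by (rule prefix_order.le_less_trans)
  qed
  ultimately have "prefix (w @ [i]) d" using d by (auto simp: prefix_snoc)
  then obtain z where z: "d = w @ [i] @ z" by (auto simp: prefix_def)
  obtain s where "s \<in> S" "d \<in> s" using d by blast
  moreover have "l < length d" "take l d = take l c" "d ! l \<noteq> c ! l"
    using z lw by (auto simp: nth_append w_def i_def)
  ultimately show ?thesis by (rule that)
qed

text \<open>A deeper \<open>c\<close> would have \<open>card S + 1\<close> star nodes strictly above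
  it. A subcover branches off at each of them, and different depths give different subcovers,
  contradicting the pigeonhole principle.\<close>

lemma sweep_cover_depth:
  assumes S: "sweep_cover (star_tree_nodes \<Delta> \<gamma>) (star_tree_arcs \<Delta> \<gamma>) [] S"
    and "\<Delta> \<ge> 2" and "finite S" and c: "c \<in> \<Union>S"
  shows "length c \<le> \<gamma> + card S * (\<gamma> + 1)"
proof (rule ccontr)
  assume deep: "\<not> ?thesis"
  define l where "l j = \<gamma> + j * (\<gamma> + 1)" for j
  have l_mod: "l j mod (\<gamma> + 1) = \<gamma>" for j
    unfolding l_def mod_mult_self1 by simp
  have l_less: "l j < length c" if "j \<le> card S" for j
  proof -
    have "j * (\<gamma> + 1) \<le> card S * (\<gamma> + 1)" using that by (rule mult_le_mono1)
    then show ?thesis using deep unfolding l_def by linarith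
  qed
  have "\<exists>s x. s \<in> S \<and> x \<in> s \<and> l j < length x \<and> take (l j) x = take (l j) c \<and> x ! l j \<noteq> c ! l j"
    if "j \<le> card S" for j
    by (rule sweep_cover_branch[OF S \<open>\<Delta> \<ge> 2\<close> c l_less[OF that] l_mod]) blast
  then obtain s x where sx: "\<And>j. j \<le> card S \<Longrightarrow> s j \<in> S \<and> x j \<in> s j \<and> l j < length (x j) \<and>
      take (l j) (x j) = take (l j) c \<and> x j ! l j \<noteq> c ! l j"
    by metis
  have neq: "s j \<noteq> s k" if jk: "j < k" "k \<le> card S" for j k
  proof
    \<comment> \<open>Siblings \<open>x j\<close> and \<open>x k\<close> agree except in their last
      entry, which comes after position \<open>l j\<close>. But at \<open>l j\<close> the node
      \<open>x k\<close> still follows \<open>c\<close>, while \<open>x j\<close> has left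
      it.\<close>
    assume eq: "s j = s k"
    have j: "s j \<in> S" "x j \<in> s j" "l j < length (x j)" "x j ! l j \<noteq> c ! l j"
      using sx[of j] jk by auto
    have k: "x k \<in> s j" "l k < length (x k)" "take (l k) (x k) = take (l k) c"
      using sx[of k] jk eq by auto
    have lt: "l j < l k"
      unfolding l_def by (intro add_strict_left_mono mult_strict_right_mono) (use jk in simp_all)
    have "s j \<noteq> {[]}" using j(2,3) by (metis list.size(3) not_less_zero singletonD)
    with sweep_cover_siblings[OF S j(1)] obtain p where "\<forall>y\<in>s j. \<exists>a. y = p @ [a]" by blast
    with j(2) k(1) obtain a b where p: "x j = p @ [a]" "x k = p @ [b]" by blast
    then have "l j < length p" using k(2) lt by simp
    then have "x j ! l j = x k ! l j" using p by (simp add: nth_append)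
    also have "\<dots> = c ! l j" using k(3) lt by (metis nth_take)
    finally show False using j by simp
  qed
  have "inj_on s {..card S}"
    by (rule linorder_inj_onI) (use neq in auto)
  moreover have "s ` {..card S} \<subseteq> S" using sx by auto
  ultimately have "card {..card S} \<le> card S" using \<open>finite S\<close> by (rule card_inj_on_le)
  then show False by simp
qed

lemma star_tree_nodes_nth:
  assumes "v \<in> star_tree_nodes \<Delta> \<gamma>" and "k < length v"
  shows "v ! k < (if k mod (\<gamma> + 1) = \<gamma> then \<Delta> else 1)"
  using assms
proof (induction rule: star_tree_nodes.induct)
  case (child v i)
  then show ?case
    by (cases "k < length v") (auto simp: nth_append star_tree_outdeg_def less_Suc_eq)
qed simp

lemma finite_star_tree_nodes_length_le:
  "finite {v \<in> star_tree_nodes \<Delta> \<gamma>. length v \<le> L}"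
proof (rule finite_subset)
  \<comment> \<open>The bound on entries is not strict, so that it admits the entry 0 even for
    \<open>\<Delta> = 0\<close>.\<close>
  show "{v \<in> star_tree_nodes \<Delta> \<gamma>. length v \<le> L} \<subseteq> {v. set v \<subseteq> {..\<Delta>} \<and> length v \<le> L}"
  proof clarsimp
    fix v a assume "v \<in> star_tree_nodes \<Delta> \<gamma>" "a \<in> set v"
    then show "a \<le> \<Delta>"
      by (induction rule: star_tree_nodes.induct)
        (auto simp: star_tree_outdeg_def split: if_splits)
  qed
qed (rule finite_lists_length_le, simp)

definition sweep_covers :: "nat \<Rightarrow> nat \<Rightarrow> nat \<Rightarrow> nat list set set set" where
  "sweep_covers \<Delta> \<gamma> n =
     {S. sweep_cover (star_tree_nodes \<Delta> \<gamma>) (star_tree_arcs \<Delta> \<gamma>) [] S \<and> finite S \<and> card S = n}"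

text \<open>The depth bound leaves finitely many nodes to build covers from. Since
  \<open>card\<close> is 0 on infinite sets, counting by injections depends on this.\<close>

lemma finite_sweep_covers:
  assumes "\<Delta> \<ge> 2"
  shows "finite (sweep_covers \<Delta> \<gamma> n)"
proof (rule finite_subset)
  let ?N = "{v \<in> star_tree_nodes \<Delta> \<gamma>. length v \<le> \<gamma> + n * (\<gamma> + 1)}"
  show "sweep_covers \<Delta> \<gamma> n \<subseteq> Pow (Pow ?N)"
  proof (intro subsetI PowI)
    fix S s v assume "S \<in> sweep_covers \<Delta> \<gamma> n" "s \<in> S" "v \<in> s"
    then have S: "sweep_cover (star_tree_nodes \<Delta> \<gamma>) (star_tree_arcs \<Delta> \<gamma>) [] S"
      "finite S" "card S = n" and v: "v \<in> \<Union>S"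
      by (auto simp: sweep_covers_def)
    have "v \<in> star_tree_nodes \<Delta> \<gamma>"
      using v sweep_cover_subset[OF S(1)] by blast
    with sweep_cover_depth[OF S(1) assms S(2) v] S(3) show "v \<in> ?N" by simp
  qed
qed (simp add: finite_star_tree_nodes_length_le)

section \<open>Grafting a sweep-cover below a child of the first star node\<close>

text \<open>Nodes above depth \<open>\<gamma>\<close> have the single child 0, so this is the only
  node at depth \<open>\<gamma>\<close>.\<close>

definition first_star :: "nat \<Rightarrow> nat list" where
  "first_star \<gamma> = replicate \<gamma> 0"

lemma replicate_0_in_star_tree_nodes:
  "k \<le> \<gamma> \<Longrightarrow> replicate k 0 \<in> star_tree_nodes \<Delta> \<gamma>"
proof (induction k)
  case (Suc k)
  have "replicate (Suc k) 0 = replicate k 0 @ [0 :: nat]" by (simp add: replicate_append_same)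
  with Suc show ?case
    by (simp only: star_tree_nodes_snoc) (simp add: star_tree_outdeg_def)
qed (simp add: star_tree_nodes.root)

lemma below_first_star_in_nodes:
  "i < \<Delta> \<Longrightarrow> first_star \<gamma> @ i # w \<in> star_tree_nodes \<Delta> \<gamma> \<longleftrightarrow> w \<in> star_tree_nodes \<Delta> \<gamma>"
  using star_tree_self_similar[of "first_star \<gamma>" \<Delta> \<gamma> i w] replicate_0_in_star_tree_nodes[of \<gamma> \<gamma> \<Delta>]
  by (simp add: first_star_def)

text \<open>The first \<open>\<gamma>\<close> entries of a node are 0, as the out-degree there is 1.
  A longer node therefore passes through a child of the first star node, whose subtree is a copy of
  the whole tree.\<close>

lemma star_tree_node_cases:
  assumes v: "v \<in> star_tree_nodes \<Delta> \<gamma>"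
  obtains "prefix v (first_star \<gamma>)"
  | i w where "i < \<Delta>" "w \<in> star_tree_nodes \<Delta> \<gamma>" "v = first_star \<gamma> @ i # w"
proof -
  have take: "take \<gamma> v = replicate (min \<gamma> (length v)) 0"
  proof (rule nth_equalityI)
    fix k assume "k < length (take \<gamma> v)"
    then show "take \<gamma> v ! k = replicate (min \<gamma> (length v)) 0 ! k"
      using star_tree_nodes_nth[OF v, of k] by simp
  qed simp
  show ?thesis
  proof (cases "length v \<le> \<gamma>")
    case True
    then have "v = take (length v) (first_star \<gamma>)" using take by (simp add: first_star_def)
    then show ?thesis using that(1) take_is_prefix by metis
  next
    case False
    then have eq: "v = first_star \<gamma> @ v ! \<gamma> # drop (Suc \<gamma>) v"
      using take id_take_nth_drop[of \<gamma> v] by (simp add: first_star_def)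
    moreover have "v ! \<gamma> < \<Delta>" using star_tree_nodes_nth[OF v, of \<gamma>] False by simp
    ultimately show ?thesis using that(2) below_first_star_in_nodes v by metis
  qed
qed

text \<open>The sets that can serve as the only subcover outside the subtree of the child \<open>i\<close>.\<close>

definition complementary :: "nat \<Rightarrow> nat \<Rightarrow> nat \<Rightarrow> nat list set \<Rightarrow> bool" where
  "complementary \<Delta> \<gamma> i s \<longleftrightarrow> s \<noteq> {} \<and> s \<subseteq> star_tree_nodes \<Delta> \<gamma> \<and>
     (\<exists>p. \<forall>x\<in>s. \<exists>k. x = p @ [k]) \<and>
     (\<forall>x\<in>s. \<exists>j w. j \<noteq> i \<and> x = first_star \<gamma> @ j # w) \<and>
     (\<forall>w\<in>star_tree_nodes \<Delta> \<gamma>. \<forall>j<\<Delta>. j \<noteq> i \<longrightarrow>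
        (\<exists>c\<in>s. prefix (first_star \<gamma> @ j # w) c \<or> prefix c (first_star \<gamma> @ j # w)))"

lemma complementary_children:
  assumes "\<Delta> \<ge> 2"
  shows "complementary \<Delta> \<gamma> i {first_star \<gamma> @ [j] | j. j < \<Delta> \<and> j \<noteq> i}"
proof -
  \<comment> \<open>A second child exists, so the set is not empty.\<close>
  have "(if i = 0 then 1 else 0) < \<Delta> \<and> (if i = 0 then 1 else 0) \<noteq> i" using assms by simp
  then have "\<exists>j. j < \<Delta> \<and> j \<noteq> i" by blast
  then show ?thesis
    by (fastforce simp: complementary_def below_first_star_in_nodes star_tree_nodes.root)
qed

text \<open>For \<open>\<gamma> > 0\<close> the child 1 has a single child of its own, which can
  cover the subtree in its place. This supplies the third choice for
  \<open>\<Delta> = 2\<close>.\<close>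

lemma complementary_grandchild:
  assumes "\<gamma> > 0"
  shows "complementary 2 \<gamma> 0 {first_star \<gamma> @ [1, 0]}"
proof -
  have "[0] \<in> star_tree_nodes 2 \<gamma>"
    using replicate_0_in_star_tree_nodes[of 1 \<gamma> 2] assms by simp
  moreover have "prefix w [0] \<or> prefix [0] w" if "w \<in> star_tree_nodes 2 \<gamma>" for w
    using star_tree_nodes_nth[OF that, of 0] assms by (cases w) auto
  moreover have "\<exists>p. \<exists>k. first_star \<gamma> @ [1, 0] = p @ [k]"
    by (rule exI[of _ "first_star \<gamma> @ [1]"]) simp
  ultimately show ?thesis
    by (auto simp: complementary_def below_first_star_in_nodes less_Suc_eq numeral_2_eq_2)
qed

text \<open>The position and the complementary set form one argument, so that a set of such choices
  can be a factor of a product.\<close>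

definition graft :: "nat \<Rightarrow> nat \<times> nat list set \<Rightarrow> nat list set set \<Rightarrow> nat list set set" where
  "graft \<gamma> = (\<lambda>(i, s) S. insert s ((`) (\<lambda>w. first_star \<gamma> @ i # w) ` S))"

text \<open>Shifting into the subtree of child \<open>i\<close> preserves and reflects the prefix
  order, and the nodes of \<open>s\<close>, lying under other children, are incomparable with the
  shifted ones.\<close>

lemma sweep_cover_graft:
  assumes S: "sweep_cover (star_tree_nodes \<Delta> \<gamma>) (star_tree_arcs \<Delta> \<gamma>) [] S"
    and i: "i < \<Delta>" and s: "complementary \<Delta> \<gamma> i s"
  shows "sweep_cover (star_tree_nodes \<Delta> \<gamma>) (star_tree_arcs \<Delta> \<gamma>) [] (graft \<gamma> (i, s) S)"
proof -
  let ?f = "\<lambda>w. first_star \<gamma> @ i # w"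
  let ?V = "star_tree_nodes \<Delta> \<gamma>"
  have s1: "s \<noteq> {}" "s \<subseteq> ?V" and s2: "\<exists>p. \<forall>x\<in>s. \<exists>k. x = p @ [k]"
    and s3: "\<And>x. x \<in> s \<Longrightarrow> \<exists>j w. j \<noteq> i \<and> x = first_star \<gamma> @ j # w"
    and s4: "\<And>w j. w \<in> ?V \<Longrightarrow> j < \<Delta> \<Longrightarrow> j \<noteq> i \<Longrightarrow>
        \<exists>c\<in>s. prefix (first_star \<gamma> @ j # w) c \<or> prefix c (first_star \<gamma> @ j # w)"
    using s unfolding complementary_def by blast+
  have inj: "inj ?f" by (simp add: inj_on_def)
  have G: "graft \<gamma> (i, s) S = insert s ((`) ?f ` S)" by (simp add: graft_def)
  have U: "\<Union>(graft \<gamma> (i, s) S) = s \<union> ?f ` \<Union>S" by (auto simp: G)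
  have sf: "s \<inter> range ?f = {}" using s3 by fastforce
  show ?thesis unfolding sweep_cover_star_tree_iff U
  proof (intro conjI)
    show "\<forall>t\<in>graft \<gamma> (i, s) S. t \<noteq> {} \<and> t \<subseteq> ?V"
    proof -
      have "?f ` t \<noteq> {} \<and> ?f ` t \<subseteq> ?V" if "t \<in> S" for t
        using sweep_cover_nonempty[OF S that] sweep_cover_subset[OF S that] i
        by (auto simp: below_first_star_in_nodes)
      with s1 show ?thesis unfolding G by simp
    qed
    show "\<forall>t\<in>graft \<gamma> (i, s) S. \<forall>t'\<in>graft \<gamma> (i, s) S. t \<noteq> t' \<longrightarrow> t \<inter> t' = {}"
    proof -
      have "?f ` t \<inter> ?f ` t' = {}" if "t \<in> S" "t' \<in> S" "?f ` t \<noteq> ?f ` t'" for t t'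
        using sweep_cover_disjoint[OF S, of t t'] that image_Int[OF inj, of t t'] by auto
      then show ?thesis using sf unfolding G by auto
    qed
    show "\<forall>t\<in>graft \<gamma> (i, s) S. t = {[]} \<or> (\<exists>p. \<forall>x\<in>t. \<exists>k. x = p @ [k])"
    proof -
      \<comment> \<open>Siblings below \<open>p\<close> become siblings below \<open>?f p\<close>;
        the singleton of the root becomes a single child of the first star node.\<close>
      have "\<exists>p. \<forall>x\<in>?f ` t. \<exists>k. x = p @ [k]" if "t \<in> S" for t
        using sweep_cover_siblings[OF S that]
      proof
        assume "\<exists>p. \<forall>x\<in>t. \<exists>k. x = p @ [k]"
        then obtain p where "\<forall>x\<in>t. \<exists>k. x = p @ [k]" ..
        then show ?thesis by (intro exI[of _ "?f p"]) fastforce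
      qed auto
      with s2 show ?thesis unfolding G by auto
    qed
    show "\<forall>v\<in>?V. \<exists>c\<in>s \<union> ?f ` \<Union>S. prefix v c \<or> prefix c v"
    proof
      fix v assume "v \<in> ?V"
      then show "\<exists>c\<in>s \<union> ?f ` \<Union>S. prefix v c \<or> prefix c v"
      proof (cases rule: star_tree_node_cases)
        case 1
        \<comment> \<open>On the initial path, \<open>v\<close> is a prefix of every node of
          \<open>s\<close>.\<close>
        from s1 s3 obtain x where "x \<in> s" "prefix (first_star \<gamma>) x" by fastforce
        with 1 show ?thesis by (meson UnI1 prefix_order.trans)
      next
        case (2 j w)
        show ?thesis
        proof (cases "j = i")
          case True
          with 2(3) have v: "v = ?f w" by simp
          from sweep_cover_covers[OF S 2(2)] obtain c
            where c: "c \<in> \<Union>S" and "prefix w c \<or> prefix c w" by blast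
          then have "prefix v (?f c) \<or> prefix (?f c) v" unfolding v by simp
          with c show ?thesis by (intro bexI[of _ "?f c"] UnI2 imageI)
        next
          case False
          with s4 2 show ?thesis by blast
        qed
      qed
    qed
    show "\<forall>c\<in>s \<union> ?f ` \<Union>S. \<forall>d\<in>s \<union> ?f ` \<Union>S. \<not> strict_prefix c d"
    proof -
      have "\<not> strict_prefix c d" if "c \<in> s" "d \<in> s" for c d
      proof -
        from s2 that obtain p k k' where "c = p @ [k]" "d = p @ [k']" by blast
        then show ?thesis by (auto dest: prefix_length_less)
      qed
      moreover have "\<not> strict_prefix (?f c) (?f d)" if "c \<in> \<Union>S" "d \<in> \<Union>S" for c d
        using sweep_cover_antichain[OF S that] by (simp add: strict_prefix_def)
      moreover have "\<not> strict_prefix x (?f d) \<and> \<not> strict_prefix (?f d) x" if x: "x \<in> s" for x d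
        using s3[OF x] by (auto simp: strict_prefix_def)
      ultimately show ?thesis by blast
    qed
  qed
qed

lemma disjoint_from_subtree:
  "complementary \<Delta> \<gamma> i s \<Longrightarrow> s \<inter> range (\<lambda>w. first_star \<gamma> @ i # w) = {}"
  unfolding complementary_def by fastforce

section \<open>Cardinality and injectivity of grafting\<close>

lemma graft_in_sweep_covers:
  assumes S: "S \<in> sweep_covers \<Delta> \<gamma> n" and i: "i < \<Delta>" and s: "complementary \<Delta> \<gamma> i s"
  shows "graft \<gamma> (i, s) S \<in> sweep_covers \<Delta> \<gamma> (Suc n)"
proof -
  let ?f = "\<lambda>w. first_star \<gamma> @ i # w"
  have "inj ?f" by (simp add: inj_on_def)
  then have "card ((`) ?f ` S) = n"
    using S by (subst card_image) (auto simp: sweep_covers_def inj_on_def inj_image_eq_iff)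
  \<comment> \<open>Being non-empty and outside the subtree, \<open>s\<close> adds exactly one
    subcover.\<close>
  moreover have "s \<notin> (`) ?f ` S"
    using disjoint_from_subtree[OF s] s by (auto simp: complementary_def)
  ultimately show ?thesis
    using sweep_cover_graft[OF _ i s] S by (auto simp: sweep_covers_def graft_def)
qed

text \<open>The position \<open>i\<close> is recognised by the subtree containing \<open>n\<close>
  of the subcovers, and \<open>s\<close> is the one left over. For \<open>n = 1\<close> this fails:
  with \<open>\<Delta> = 2\<close>, the two children of the first star node as singletons arise from
  both positions.\<close>

lemma graft_inject:
  assumes S: "S \<in> sweep_covers \<Delta> \<gamma> n" and "n \<ge> 2"
    and S': "S' \<in> sweep_covers \<Delta> \<gamma> n"
    and s: "complementary \<Delta> \<gamma> i s" and s': "complementary \<Delta> \<gamma> i' s'"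
    and eq: "graft \<gamma> (i, s) S = graft \<gamma> (i', s') S'"
  shows "i = i'" "s = s'" "S = S'"
proof -
  define f where "f = (\<lambda>i w. first_star \<gamma> @ i # w)"
  have eq: "insert s ((`) (f i) ` S) = insert s' ((`) (f i') ` S')"
    using eq by (simp add: graft_def f_def)
  have inj: "inj ((`) (f j))" for j by (auto simp: f_def inj_def inj_image_eq_iff)
  have ne: "t \<noteq> {}" if "t \<in> S" for t
    using sweep_cover_nonempty[of \<Delta> \<gamma> S t] that S by (simp add: sweep_covers_def)
  show i: "i = i'"
  proof (rule ccontr)
    assume "i \<noteq> i'"
    then have "f i w \<noteq> f i' w'" for w w' by (simp add: f_def)
    then have neq: "f i ` t \<noteq> f i' ` t'" if "t \<in> S" for t t'
      using ne[OF that] by (metis ex_in_conv imageE imageI)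
    \<comment> \<open>Shifted members of \<open>S\<close> and \<open>S'\<close> lie in different
      subtrees, so all \<open>n \<ge> 2\<close> shifted members of \<open>S\<close> would have to
      equal \<open>s'\<close>.\<close>
    have "(`) (f i) ` S \<subseteq> {s'}"
    proof
      fix u assume u: "u \<in> (`) (f i) ` S"
      then have "u \<in> insert s' ((`) (f i') ` S')" unfolding eq[symmetric] by simp
      moreover have "u \<notin> (`) (f i') ` S'" using u neq by auto
      ultimately show "u \<in> {s'}" by simp
    qed
    then have "card ((`) (f i) ` S) \<le> 1"
      using card_mono[of "{s'}" "(`) (f i) ` S"] by simp
    moreover have "card ((`) (f i) ` S) = n"
      using S inj_on_subset[OF inj] by (simp add: card_image sweep_covers_def)
    ultimately show False using \<open>n \<ge> 2\<close> by simp
  qed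
  have s_notin: "s \<notin> (`) (f i) ` T" for T
    using disjoint_from_subtree[OF s] s by (auto simp: complementary_def f_def)
  have "s \<in> insert s' ((`) (f i') ` S')" unfolding eq[symmetric] by simp
  with s_notin i show "s = s'" by simp
  with eq i s_notin have "(`) (f i) ` S = (`) (f i) ` S'" by (simp add: insert_ident)
  then show "S = S'" using inj by (simp add: inj_image_eq_iff)
qed

section \<open>Geometric growth of the number of sweep-covers\<close>

lemma three_grafts:
  assumes "\<Delta> \<ge> 2" and "\<gamma> > 0"
  obtains K where "card K = 3" "\<And>i s. (i, s) \<in> K \<Longrightarrow> i < \<Delta> \<and> complementary \<Delta> \<gamma> i s"
proof -
  define c where "c i = {first_star \<gamma> @ [j] | j. j < \<Delta> \<and> j \<noteq> i}" for i
  have c: "complementary \<Delta> \<gamma> i (c i)" for i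
    using complementary_children[OF assms(1)] by (simp add: c_def)
  define k :: "nat \<times> nat list set"
    where "k = (if \<Delta> = 2 then (0, {first_star \<gamma> @ [1, 0]}) else (2, c 2))"
  \<comment> \<open>For \<open>\<Delta> = 2\<close> two of the choices share position 0 and must
    differ in their sets.\<close>
  have "first_star \<gamma> @ [1, 0] \<notin> c 0" by (auto simp: c_def)
  then have "c 0 \<noteq> {first_star \<gamma> @ [1, 0]}" by blast
  then have "card {(0, c 0), (1, c 1), k} = 3" by (auto simp: k_def card_insert_if)
  moreover have "i < \<Delta> \<and> complementary \<Delta> \<gamma> i s" if "(i, s) \<in> {(0, c 0), (1, c 1), k}" for i s
    using that c assms complementary_grandchild[OF assms(2)] by (auto simp: k_def split: if_splits)
  ultimately show ?thesis by (rule that)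
qed

text \<open>Grafting embeds the product of three choices and the covers with \<open>n\<close>
  subcovers. The factor 3 matches the bound \<open>3 ^ n\<close> on the claimed expression.\<close>

lemma num_sweep_covers_Suc_ge:
  assumes "\<Delta> \<ge> 2" and "\<gamma> > 0" and "n \<ge> 2"
  shows "3 * num_sweep_covers \<Delta> \<gamma> n \<le> num_sweep_covers \<Delta> \<gamma> (Suc n)"
proof -
  obtain K where K: "card K = 3" "\<And>i s. (i, s) \<in> K \<Longrightarrow> i < \<Delta> \<and> complementary \<Delta> \<gamma> i s"
    using three_grafts[OF assms(1,2)] by blast
  let ?g = "\<lambda>(k, S). graft \<gamma> k S"
  have "inj_on ?g (K \<times> sweep_covers \<Delta> \<gamma> n)"
  proof (rule inj_onI)
    fix x y
    assume x: "x \<in> K \<times> sweep_covers \<Delta> \<gamma> n" and y: "y \<in> K \<times> sweep_covers \<Delta> \<gamma> n"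
      and eq: "?g x = ?g y"
    obtain i s S i' s' S' where xy: "x = ((i, s), S)" "y = ((i', s'), S')"
      by (metis prod.collapse)
    have S: "S \<in> sweep_covers \<Delta> \<gamma> n" "S' \<in> sweep_covers \<Delta> \<gamma> n"
      and s: "complementary \<Delta> \<gamma> i s" "complementary \<Delta> \<gamma> i' s'"
      using x y xy K(2) by auto
    have "graft \<gamma> (i, s) S = graft \<gamma> (i', s') S'" using eq xy by simp
    from graft_inject[OF S(1) \<open>n \<ge> 2\<close> S(2) s this] show "x = y" by (simp add: xy)
  qed
  moreover have "?g ` (K \<times> sweep_covers \<Delta> \<gamma> n) \<subseteq> sweep_covers \<Delta> \<gamma> (Suc n)"
    using graft_in_sweep_covers K(2) by fastforce
  ultimately have "card (K \<times> sweep_covers \<Delta> \<gamma> n) \<le> card (sweep_covers \<Delta> \<gamma> (Suc n))"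
    using finite_sweep_covers[OF assms(1)] by (rule card_inj_on_le)
  then show ?thesis
    using K(1) by (simp add: card_cartesian_product num_sweep_covers_def sweep_covers_def)
qed

lemma num_sweep_covers_ge:
  assumes "\<Delta> \<ge> 2" and "\<gamma> > 0"
  shows "3 ^ k \<le> num_sweep_covers \<Delta> \<gamma> (k + 2)"
proof (induction k)
  case 0
  \<comment> \<open>The induction starts from two subcovers because injectivity needs
    \<open>n \<ge> 2\<close>; grafting the singleton of the root gives such a cover.\<close>
  have "{{[]}} \<in> sweep_covers \<Delta> \<gamma> 1"
    by (simp add: sweep_covers_def sweep_cover_star_tree_iff star_tree_nodes.root)
  then have "graft \<gamma> (0, {first_star \<gamma> @ [j] | j. j < \<Delta> \<and> j \<noteq> 0}) {{[]}} \<in> sweep_covers \<Delta> \<gamma> (Suc 1)"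
    by (rule graft_in_sweep_covers) (use assms(1) in simp, rule complementary_children[OF assms(1)])
  then have "card (sweep_covers \<Delta> \<gamma> 2) > 0"
    using finite_sweep_covers[OF assms(1)] by (auto simp: card_gt_0_iff numeral_2_eq_2)
  then show ?case by (simp add: num_sweep_covers_def sweep_covers_def Suc_le_eq numeral_2_eq_2)
next
  case (Suc k)
  have "3 ^ Suc k \<le> 3 * num_sweep_covers \<Delta> \<gamma> (k + 2)" using Suc by simp
  also have "\<dots> \<le> num_sweep_covers \<Delta> \<gamma> (Suc (k + 2))"
    by (rule num_sweep_covers_Suc_ge[OF assms]) simp
  finally show ?case by simp
qed

section \<open>The asymptotic estimate\<close>

text \<open>\<open>m ^ m / fact m\<close> is one term of the exponential series at \<open>m\<close>,
  whose terms are all non-negative.\<close>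

lemma power_self_le_exp_mult_fact: "real m ^ m \<le> exp (real m) * fact m"
proof -
  have "(\<Sum>k\<in>{m}. real m ^ k /\<^sub>R fact k) \<le> (\<Sum>k. real m ^ k /\<^sub>R fact k)"
    by (intro sum_le_suminf summable_exp_generic) auto
  then show ?thesis by (simp add: exp_def field_simps)
qed

lemma fact_mult_power_le_fact_add: "fact m * real m ^ k \<le> fact (m + k)"
proof (induction k)
  case (Suc k)
  have "fact m * real m ^ Suc k \<le> fact (m + k) * real (m + k + 1)"
    using mult_mono[OF Suc, of "real m" "real (m + k + 1)"] by (simp add: mult_ac)
  then show ?case by (simp add: algebra_simps)
qed simp

lemma exp_le_mult_power_self:
  fixes d :: nat
  assumes "d \<ge> 1"
  shows "exp (real d) \<le> 3 * real d ^ d"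
proof -
  \<comment> \<open>Multiplied by \<open>d\<close>, this gives \<open>d \<le> 1 + d * ln d\<close>,
    whose exponential is the claim with \<open>exp 1\<close> for 3.\<close>
  have "ln (1 / real d) \<le> 1 / real d - 1"
    using assms by (intro ln_le_minus_one) simp
  then have "real d \<le> 1 + real d * ln (real d)"
    using assms by (simp add: ln_div field_simps)
  then have "exp (real d) \<le> exp (1 + real d * ln (real d))" by simp
  also have "\<dots> = exp 1 * real d ^ d"
    using assms by (simp add: exp_add exp_of_nat_mult)
  also have "\<dots> \<le> 3 * real d ^ d"
    by (intro mult_right_mono exp_le) simp
  finally show ?thesis .
qed

text \<open>With \<open>d = \<Delta> - 1\<close>, the power of \<open>n\<close> splits so that
  \<open>dn + d + 2\<close> factors are absorbed by \<open>3 ^ n\<close> and the first factorial,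
  and \<open>n + 1\<close> factors by \<open>exp n\<close> and the second.\<close>

lemma star_tree_bound_le:
  fixes \<Delta> n :: nat
  assumes "\<Delta> \<ge> 2" and "n \<ge> 1"
  shows "real n powr (real \<Delta> * real n + real \<Delta> + 3 / 2)
      / (exp (real n) * fact ((\<Delta> - 1) * n + \<Delta> + 1) * fact (n + 1)) \<le> 3 ^ n"
proof -
  define d where "d = \<Delta> - 1"
  have d: "d \<ge> 1" "\<Delta> = Suc d" using assms by (auto simp: d_def)
  let ?m = "d * n" and ?x = "real n"
  \<comment> \<open>The exponent is rounded up by 1/2 to an integer, which only increases the power
    as \<open>n \<ge> 1\<close>.\<close>
  have "?x powr (real \<Delta> * ?x + real \<Delta> + 3 / 2) \<le> ?x powr real (?m + n + (d + 2) + 1)"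
    using assms by (intro powr_mono) (auto simp: d algebra_simps)
  also have "\<dots> = ?x ^ (?m + n + (d + 2) + 1)"
    using assms by (intro powr_realpow) simp
  finally have num: "?x powr (real \<Delta> * ?x + real \<Delta> + 3 / 2) \<le> ?x ^ (?m + n + (d + 2) + 1)" .
  have "exp (real ?m) = exp (real d) ^ n"
    using exp_of_nat_mult[of n "real d"] by (simp add: mult.commute)
  also have "\<dots> \<le> (3 * real d ^ d) ^ n"
    by (intro power_mono exp_le_mult_power_self d) simp
  finally have e: "exp (real ?m) \<le> 3 ^ n * real d ^ ?m"
    by (simp add: power_mult_distrib power_mult)
  \<comment> \<open>The factor \<open>d ^ (d * n)\<close> appears on both ends of this chain and
    cancels.\<close>
  have "real d ^ ?m * ?x ^ ?m = real ?m ^ ?m" by (simp add: power_mult_distrib)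
  also have "\<dots> \<le> exp (real ?m) * fact ?m" by (rule power_self_le_exp_mult_fact)
  also have "\<dots> \<le> 3 ^ n * real d ^ ?m * fact ?m" using e by (rule mult_right_mono) simp
  finally have "?x ^ ?m \<le> 3 ^ n * fact ?m"
    using d by (simp add: mult_ac)
  \<comment> \<open>Since \<open>n \<le> d * n\<close>, the remaining factors \<open>n\<close> can
    be raised to \<open>d * n\<close> and extend the factorial.\<close>
  then have "?x ^ ?m * ?x ^ (d + 2) \<le> 3 ^ n * fact ?m * real ?m ^ (d + 2)"
    using d by (intro mult_mono power_mono) (auto simp: mult_le_cancel_right1)
  also have "\<dots> \<le> 3 ^ n * fact (?m + (d + 2))"
    using fact_mult_power_le_fact_add[of ?m "d + 2"] by (simp add: mult.assoc)
  finally have A: "?x ^ ?m * ?x ^ (d + 2) \<le> 3 ^ n * fact (?m + (d + 2))" .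
  have "?x ^ n * ?x \<le> exp ?x * fact n * ?x"
    by (intro mult_right_mono power_self_le_exp_mult_fact) simp
  also have "\<dots> \<le> exp ?x * fact (n + 1)"
    using fact_mult_power_le_fact_add[of n 1] by (simp add: mult.assoc)
  finally have B: "?x ^ n * ?x \<le> exp ?x * fact (n + 1)" .
  have "?x ^ (?m + n + (d + 2) + 1) = (?x ^ ?m * ?x ^ (d + 2)) * (?x ^ n * ?x)"
    by (simp add: power_add mult_ac)
  also have "\<dots> \<le> (3 ^ n * fact (?m + (d + 2))) * (exp ?x * fact (n + 1))"
    by (intro mult_mono A B) auto
  finally have "?x powr (real \<Delta> * ?x + real \<Delta> + 3 / 2)
      \<le> 3 ^ n * (exp ?x * fact (?m + (d + 2)) * fact (n + 1))"
    using num by (simp add: mult_ac)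
  moreover have "(\<Delta> - 1) * n + \<Delta> + 1 = ?m + (d + 2)" by (simp add: d)
  ultimately show ?thesis by (simp only: pos_divide_le_eq fact_gt_zero exp_gt_zero mult_pos_pos)
qed

theorem theorem3:
  fixes \<Delta> \<gamma> :: nat
  assumes "\<Delta> \<ge> 2"
  shows "(\<lambda>n. real (num_sweep_covers \<Delta> \<gamma> n)) \<in>
    \<Omega>(\<lambda>n. sqrt (2 * pi) * real n powr (real \<Delta> * real n + real \<Delta> + 3 / 2)
            / (exp (real n) * fact ((\<Delta> - 1) * n + \<Delta> + 1) * fact (n + 1)) * real \<gamma>)"
    (is "?P \<in> \<Omega>(?g)")
\<comment> \<open>For \<open>\<gamma> = 0\<close> the bounding function is identically zero.\<close>
proof (cases "\<gamma> = 0")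
  case False
  have "?g \<in> O(?P)"
  proof (rule bigoI)
    \<comment> \<open>The 9 is \<open>3 ^ 2\<close>: the lower bound on the count is
      \<open>3 ^ (n - 2)\<close>, the upper bound on the quotient \<open>3 ^ n\<close>.\<close>
    show "\<forall>\<^sub>F n in sequentially. norm (?g n) \<le> (sqrt (2 * pi) * real \<gamma> * 9) * norm (?P n)"
      using eventually_ge_at_top[of 2]
    proof eventually_elim
      case (elim n)
      let ?q = "real n powr (real \<Delta> * real n + real \<Delta> + 3 / 2)
            / (exp (real n) * fact ((\<Delta> - 1) * n + \<Delta> + 1) * fact (n + 1))"
      have "3 ^ (n - 2) \<le> num_sweep_covers \<Delta> \<gamma> n"
        using num_sweep_covers_ge[OF assms, of \<gamma> "n - 2"] False elim
        by (simp del: add_2_eq_Suc')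
      then have "3 ^ (n - 2) \<le> ?P n"
        by (metis of_nat_le_iff of_nat_numeral of_nat_power)
      moreover have "(3::real) ^ n = 9 * 3 ^ (n - 2)"
        using power_add[of "3 :: real" 2 "n - 2"] unfolding le_add_diff_inverse[OF elim] by simp
      ultimately have "?q \<le> 9 * ?P n"
        using star_tree_bound_le[OF assms, of n] elim by linarith
      then have "(sqrt (2 * pi) * real \<gamma>) * ?q \<le> (sqrt (2 * pi) * real \<gamma>) * (9 * ?P n)"
        by (rule mult_left_mono) simp
      moreover have "norm (?g n) = (sqrt (2 * pi) * real \<gamma>) * ?q"
        by (simp add: abs_mult)
      ultimately show ?case by (simp only: real_norm_def abs_of_nat mult.assoc)
    qed
  qed
  then show ?thesis by (simp add: bigomega_iff_bigo)
qed simp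

end
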